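(* For non-commuting indeterminates $x,y$ let $u=\tfrac12(x+y)$, $v=\tfrac12(x-y)$, $\pi(x,y)=(u,v^2,vuv)$ and $p_{-n}=x^{-n}+y^{-n}$. For every non-negative integer $n$ there exists a rational function $P_{-n}$ in three non-commuting variables such that $p_{-n}=P_{-n}\circ\pi$. The functions $P_{-n}$ are given recursively by $P_0(\alpha,\beta,\gamma)=2$, $Q_0(\alpha,\beta,\gamma)=0$ and, for $n\ge0$, $$P_{-(n+1)}(\alpha,\beta,\gamma)=(\alpha-\beta\gamma^{-1}\beta)^{-1}P_{-n}+(\beta-\gamma\beta^{-1}\alpha)^{-1}Q_{-n},$$ $$Q_{-(n+1)}(\alpha,\beta,\gamma)=\beta(\beta-\alpha\beta^{-1}\gamma)^{-1}P_{-n}+\beta(\gamma-\beta\alpha^{-1}\beta)^{-1}Q_{-n}.$$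
   Context: A non-commutative rational expression is one built from non-commuting variables by sums, products, complex scalar multiples and inverses; it is nondegenerate if it can be evaluated at some tuple of square complex matrices of some common size, and a non-commutative rational function is an equivalence class of nondegenerate expressions that agree wherever both are defined on matrix tuples. The identity $p_{-n}=P_{-n}\circ\pi$ is understood as an identity of non-commutative rational functions in $x,y$, i.e. $x^{-n}+y^{-n}=P_{-n}(u,v^2,vuv)$ whenever $x,y$ are square complex matrices of the same size for which both sides can be evaluated. *)

theory Defs
  imports Complex_Main "Jordan_Normal_Form.Gauss_Jordan_Elimination"
begin

section \<open>Non-commutative rational expressions\<close>

text \<open>The constructor \<open>One\<close> is the empty product; constants are its scalar multiples.\<close>

datatype 'v nc_expr =
    Var 'v
  | One
  | Scale complex "'v nc_expr"
  | Add "'v nc_expr" "'v nc_expr"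
  | Mul "'v nc_expr" "'v nc_expr"
  | Inv "'v nc_expr"

definition mat_tuple :: "nat \<Rightarrow> ('v \<Rightarrow> complex mat) \<Rightarrow> bool" where
  "mat_tuple k Z \<longleftrightarrow> (\<forall>v. Z v \<in> carrier_mat k k)"

text \<open>Evaluation at a tuple of \<open>k \<times> k\<close> matrices; \<open>None\<close> means that some subexpression
  under an inverse evaluates to a singular matrix.\<close>

primrec nc_eval :: "nat \<Rightarrow> ('v \<Rightarrow> complex mat) \<Rightarrow> 'v nc_expr \<Rightarrow> complex mat option" where
  "nc_eval k Z (Var v) = Some (Z v)"
| "nc_eval k Z One = Some (1\<^sub>m k)"
| "nc_eval k Z (Scale c r) = Option.bind (nc_eval k Z r) (\<lambda>A. Some (c \<cdot>\<^sub>m A))"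
| "nc_eval k Z (Add r s) =
     Option.bind (nc_eval k Z r) (\<lambda>A. Option.bind (nc_eval k Z s) (\<lambda>B. Some (A + B)))"
| "nc_eval k Z (Mul r s) =
     Option.bind (nc_eval k Z r) (\<lambda>A. Option.bind (nc_eval k Z s) (\<lambda>B. Some (A * B)))"
| "nc_eval k Z (Inv r) = Option.bind (nc_eval k Z r) mat_inverse"

text \<open>The size must be positive: every expression can be evaluated at \<open>0 \<times> 0\<close> matrices.\<close>

definition nondegenerate :: "'v nc_expr \<Rightarrow> bool" where
  "nondegenerate r \<longleftrightarrow> (\<exists>k>0. \<exists>Z A. mat_tuple k Z \<and> nc_eval k Z r = Some A)"

primrec nc_subst :: "('v \<Rightarrow> 'w nc_expr) \<Rightarrow> 'v nc_expr \<Rightarrow> 'w nc_expr" where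
  "nc_subst g (Var v) = g v"
| "nc_subst g One = One"
| "nc_subst g (Scale c r) = Scale c (nc_subst g r)"
| "nc_subst g (Add r s) = Add (nc_subst g r) (nc_subst g s)"
| "nc_subst g (Mul r s) = Mul (nc_subst g r) (nc_subst g s)"
| "nc_subst g (Inv r) = Inv (nc_subst g r)"


section \<open>Non-commutative rational functions\<close>

definition nc_equiv :: "('v nc_expr \<times> 'v nc_expr) set" where
  "nc_equiv = {(r, s). nondegenerate r \<and> nondegenerate s \<and>
     (\<forall>k>0. \<forall>Z A B. mat_tuple k Z \<longrightarrow> nc_eval k Z r = Some A \<longrightarrow> nc_eval k Z s = Some B \<longrightarrow> A = B)}"

type_synonym 'v nc_fun = "'v nc_expr set"

definition nc_functions :: "'v nc_fun set" where
  "nc_functions = {r. nondegenerate r} // nc_equiv"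

text \<open>Operations on equivalence classes, through representatives. As \<^term>\<open>nc_equiv\<close> relates
  only nondegenerate expressions, degenerate combinations of representatives contribute
  nothing; an operation that is undefined (such as the inverse of zero, or a composition none of
  whose representatives can be evaluated anywhere) yields the empty set, which is not
  an element of \<^term>\<open>nc_functions\<close>.\<close>

definition nc_var :: "'v \<Rightarrow> 'v nc_fun" where
  "nc_var v = nc_equiv `` {Var v}"

definition nc_const :: "complex \<Rightarrow> 'v nc_fun" where
  "nc_const c = nc_equiv `` {Scale c One}"

definition nc_scale :: "complex \<Rightarrow> 'v nc_fun \<Rightarrow> 'v nc_fun" (infixr "\<cdot>\<^sub>r" 75) where
  "c \<cdot>\<^sub>r F = nc_equiv `` {Scale c r |r. r \<in> F}"

definition nc_add :: "'v nc_fun \<Rightarrow> 'v nc_fun \<Rightarrow> 'v nc_fun" (infixl "+\<^sub>r" 65) where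
  "F +\<^sub>r G = nc_equiv `` {Add r s |r s. r \<in> F \<and> s \<in> G}"

definition nc_diff :: "'v nc_fun \<Rightarrow> 'v nc_fun \<Rightarrow> 'v nc_fun" (infixl "-\<^sub>r" 65) where
  "F -\<^sub>r G = F +\<^sub>r (-1) \<cdot>\<^sub>r G"

definition nc_mult :: "'v nc_fun \<Rightarrow> 'v nc_fun \<Rightarrow> 'v nc_fun" (infixl "*\<^sub>r" 70) where
  "F *\<^sub>r G = nc_equiv `` {Mul r s |r s. r \<in> F \<and> s \<in> G}"

definition nc_inv :: "'v nc_fun \<Rightarrow> 'v nc_fun" where
  "nc_inv F = nc_equiv `` {Inv r |r. r \<in> F}"

primrec nc_power :: "'v nc_fun \<Rightarrow> nat \<Rightarrow> 'v nc_fun" (infixr "^\<^sub>r" 80) where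
  "F ^\<^sub>r 0 = nc_const 1"
| "F ^\<^sub>r Suc n = F *\<^sub>r F ^\<^sub>r n"

definition nc_compose :: "'v nc_fun \<Rightarrow> ('v \<Rightarrow> 'w nc_fun) \<Rightarrow> 'w nc_fun" (infixl "\<circ>\<^sub>r" 55) where
  "F \<circ>\<^sub>r G = nc_equiv `` {nc_subst g r |g r. r \<in> F \<and> (\<forall>v. g v \<in> G v)}"

text \<open>A rational function can be evaluated wherever one of its representatives can.\<close>

definition nc_value :: "nat \<Rightarrow> 'v nc_fun \<Rightarrow> ('v \<Rightarrow> complex mat) \<Rightarrow> complex mat \<Rightarrow> bool" where
  "nc_value k F Z A \<longleftrightarrow> (\<exists>r\<in>F. nc_eval k Z r = Some A)"


section \<open>The two sets of variables\<close>

datatype two_vars = X_var | Y_var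

datatype three_vars = Alpha_var | Beta_var | Gamma_var

fun pair2 :: "'a \<Rightarrow> 'a \<Rightarrow> two_vars \<Rightarrow> 'a" where
  "pair2 a b X_var = a"
| "pair2 a b Y_var = b"

fun triple3 :: "'a \<Rightarrow> 'a \<Rightarrow> 'a \<Rightarrow> three_vars \<Rightarrow> 'a" where
  "triple3 a b c Alpha_var = a"
| "triple3 a b c Beta_var = b"
| "triple3 a b c Gamma_var = c"

definition u_fun :: "two_vars nc_fun" where
  "u_fun = (1/2) \<cdot>\<^sub>r (nc_var X_var +\<^sub>r nc_var Y_var)"

definition v_fun :: "two_vars nc_fun" where
  "v_fun = (1/2) \<cdot>\<^sub>r (nc_var X_var -\<^sub>r nc_var Y_var)"

definition \<pi>_fun :: "three_vars \<Rightarrow> two_vars nc_fun" where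
  "\<pi>_fun = triple3 u_fun (v_fun *\<^sub>r v_fun) (v_fun *\<^sub>r u_fun *\<^sub>r v_fun)"

definition p_neg :: "nat \<Rightarrow> two_vars nc_fun" where
  "p_neg n = nc_inv (nc_var X_var) ^\<^sub>r n +\<^sub>r nc_inv (nc_var Y_var) ^\<^sub>r n"

definition u_mat :: "complex mat \<Rightarrow> complex mat \<Rightarrow> complex mat" where
  "u_mat x y = (1/2) \<cdot>\<^sub>m (x + y)"

definition v_mat :: "complex mat \<Rightarrow> complex mat \<Rightarrow> complex mat" where
  "v_mat x y = (1/2) \<cdot>\<^sub>m (x - y)"

definition \<pi>_mat :: "complex mat \<Rightarrow> complex mat \<Rightarrow> three_vars \<Rightarrow> complex mat" where
  "\<pi>_mat x y = (let u = u_mat x y; v = v_mat x y in triple3 u (v * v) (v * u * v))"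

end

theory Submission
  imports Defs "Jordan_Normal_Form.Char_Poly"
begin

text \<open>Put \<open>a = (x\<^sup>-\<^sup>1 + y\<^sup>-\<^sup>1) / 2\<close> and \<open>b = (x\<^sup>-\<^sup>1 - y\<^sup>-\<^sup>1) / 2\<close>. As \<open>x = u + v\<close> and \<open>y = u - v\<close>, these are
  \<open>a = (u - v u\<^sup>-\<^sup>1 v)\<^sup>-\<^sup>1\<close> and \<open>b = (v - u v\<^sup>-\<^sup>1 u)\<^sup>-\<^sup>1\<close>, so at \<open>(\<alpha>, \<beta>, \<gamma>) = (u, v\<^sup>2, v u v)\<close> the four
  coefficients of the recursion are \<open>a\<close>, \<open>b v\<^sup>-\<^sup>1\<close>, \<open>v b\<close> and \<open>v a v\<^sup>-\<^sup>1\<close>. By induction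
  \<open>P\<^sub>-\<^sub>n = x\<^sup>-\<^sup>n + y\<^sup>-\<^sup>n\<close> and \<open>Q\<^sub>-\<^sub>n = v (x\<^sup>-\<^sup>n - y\<^sup>-\<^sup>n)\<close>, because \<open>x\<^sup>-\<^sup>1 = a + b\<close> and \<open>y\<^sup>-\<^sup>1 = a - b\<close>.

  That rational functions are well defined requires agreement on the common domain to be a
  transitive relation, which holds because domains are Zariski open and, after passing to a
  multiple of the matrix size, nonempty.\<close>

section \<open>Evaluation of expressions\<close>

text \<open>A right inverse of a square matrix over a field is two-sided and therefore unique. So
  one product equation decides every inverse met during evaluation.\<close>

lemma mat_inverse_eq_Some_iff:
  fixes A :: "'a :: field mat"
  assumes A: "A \<in> carrier_mat k k"
  shows "mat_inverse A = Some B \<longleftrightarrow> B \<in> carrier_mat k k \<and> A * B = 1\<^sub>m k"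
proof
  assume "mat_inverse A = Some B"
  then show "B \<in> carrier_mat k k \<and> A * B = 1\<^sub>m k"
    using mat_inverse(2)[OF A] by blast
next
  assume B: "B \<in> carrier_mat k k \<and> A * B = 1\<^sub>m k"
  then have BA: "B * A = 1\<^sub>m k"
    using mat_mult_left_right_inverse[OF A] by blast
  \<comment> \<open>Success of \<open>mat_inverse\<close> is obtained by contradiction: the result
    \<open>None\<close> would mean that \<open>A\<close> is not a unit of the matrix ring.\<close>
  have "A \<in> Units (ring_mat TYPE('a) k undefined)"
    using A B BA by (auto simp: Units_def ring_mat_simps)
  then obtain C where C: "mat_inverse A = Some C"
    using mat_inverse(1)[OF A] by fastforce
  have C': "A * C = 1\<^sub>m k" "C \<in> carrier_mat k k"
    using mat_inverse(2)[OF A C] by auto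
  have "C = (B * A) * C"
    using C' BA by simp
  also have "\<dots> = B * (A * C)"
    using A B C' by (intro assoc_mult_mat) auto
  also have "\<dots> = B"
    using B C' by auto
  finally show "mat_inverse A = Some B"
    using C by simp
qed

lemma nc_eval_carrier:
  assumes "mat_tuple k Z" "nc_eval k Z r = Some A"
  shows "A \<in> carrier_mat k k"
  using assms(2)
proof (induction r arbitrary: A)
  case (Inv r)
  then obtain B where B: "nc_eval k Z r = Some B" "mat_inverse B = Some A"
    by (auto simp: bind_eq_Some_conv)
  then show ?case
    using Inv.IH mat_inverse_eq_Some_iff by blast
qed (use assms(1) in \<open>fastforce simp: mat_tuple_def bind_eq_Some_conv\<close>)+

text \<open>Only variables occurring in \<open>r\<close> are constrained, which is what later
  permits a point to be patched together for two expressions in different variables.\<close>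

lemma nc_eval_subst:
  assumes "\<And>v. v \<in> set_nc_expr r \<Longrightarrow> nc_eval k Z (g v) = Some (W v)"
  shows "nc_eval k Z (nc_subst g r) = nc_eval k W r"
  using assms by (induction r) simp_all

text \<open>\<open>None\<close> propagates through every constructor, so a single undefined inner
  value at an occurring variable would make the whole composition undefined.\<close>

lemma nc_eval_subst_defined:
  assumes "nc_eval k Z (nc_subst g r) = Some A" "v \<in> set_nc_expr r"
  shows "\<exists>B. nc_eval k Z (g v) = Some B"
  using assms by (induction r arbitrary: A) (auto simp: bind_eq_Some_conv)

section \<open>Block diagonal points\<close>

definition block_diag :: "'a::zero mat \<Rightarrow> 'a mat \<Rightarrow> 'a mat" where
  "block_diag A B =
     four_block_mat A (0\<^sub>m (dim_row A) (dim_col B)) (0\<^sub>m (dim_row B) (dim_col A)) B"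

lemma block_diag_carrier:
  "A \<in> carrier_mat k k \<Longrightarrow> B \<in> carrier_mat l l \<Longrightarrow> block_diag A B \<in> carrier_mat (k + l) (k + l)"
  by (auto simp: block_diag_def)

lemma block_diag_inject_left:
  assumes "block_diag A B = block_diag C D" "A \<in> carrier_mat k k" "C \<in> carrier_mat k k"
    "B \<in> carrier_mat l l" "D \<in> carrier_mat l l"
  shows "A = C"
proof (rule eq_matI)
  fix i j assume ij: "i < dim_row C" "j < dim_col C"
  have "A $$ (i, j) = block_diag A B $$ (i, j)"
    using assms(2-) ij by (auto simp: block_diag_def)
  also have "\<dots> = C $$ (i, j)"
    unfolding assms(1) using assms(2-) ij by (auto simp: block_diag_def)
  finally show "A $$ (i, j) = C $$ (i, j)" .
qed (use assms in auto)

lemma mult_block_diag: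
  assumes "A \<in> carrier_mat k k" "C \<in> carrier_mat k k" "B \<in> carrier_mat l l" "D \<in> carrier_mat l l"
  shows "block_diag A B * block_diag C D = block_diag (A * C) (B * D)"
  unfolding block_diag_def using assms
  by (subst mult_four_block_mat[of _ k k _ l _ l _ _ k _ l]) auto

text \<open>Direct sums of tuples serve to change the matrix size: all operations act blockwise, and
  the inverse of a block diagonal matrix has the inverses as its blocks.\<close>

lemma nc_eval_block_diag:
  fixes k l :: nat
  assumes Z: "mat_tuple k Z" and W: "mat_tuple l W"
  shows "nc_eval k Z r = Some A \<Longrightarrow> nc_eval l W r = Some B \<Longrightarrow>
    nc_eval (k + l) (\<lambda>v. block_diag (Z v) (W v)) r = Some (block_diag A B)"
proof (induction r arbitrary: A B)
  case One
  then show ?case by (auto simp: block_diag_def)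
next
  case (Scale c r)
  then obtain A' B' where *: "nc_eval k Z r = Some A'" "nc_eval l W r = Some B'"
    "A = c \<cdot>\<^sub>m A'" "B = c \<cdot>\<^sub>m B'"
    by (auto simp: bind_eq_Some_conv)
  have "A' \<in> carrier_mat k k" "B' \<in> carrier_mat l l"
    using * Z W nc_eval_carrier by blast+
  then have "c \<cdot>\<^sub>m block_diag A' B' = block_diag A B"
    unfolding *(3,4) by (intro eq_matI) (auto simp: block_diag_def)
  then show ?case
    using * Scale.IH by simp
next
  case (Add r s)
  then obtain A1 B1 A2 B2 where *: "nc_eval k Z r = Some A1" "nc_eval l W r = Some B1"
    "nc_eval k Z s = Some A2" "nc_eval l W s = Some B2" "A = A1 + A2" "B = B1 + B2"
    by (auto simp: bind_eq_Some_conv)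
  have "A1 \<in> carrier_mat k k" "B1 \<in> carrier_mat l l" "A2 \<in> carrier_mat k k" "B2 \<in> carrier_mat l l"
    using * Z W nc_eval_carrier by blast+
  then have "block_diag A1 B1 + block_diag A2 B2 = block_diag A B"
    unfolding *(5,6) by (intro eq_matI) (auto simp: block_diag_def)
  then show ?case
    using * Add.IH by simp
next
  case (Mul r s)
  then obtain A1 B1 A2 B2 where *: "nc_eval k Z r = Some A1" "nc_eval l W r = Some B1"
    "nc_eval k Z s = Some A2" "nc_eval l W s = Some B2" "A = A1 * A2" "B = B1 * B2"
    by (auto simp: bind_eq_Some_conv)
  have "A1 \<in> carrier_mat k k" "B1 \<in> carrier_mat l l" "A2 \<in> carrier_mat k k" "B2 \<in> carrier_mat l l"
    using * Z W nc_eval_carrier by blast+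
  then have "block_diag A1 B1 * block_diag A2 B2 = block_diag A B"
    unfolding *(5,6) by (intro mult_block_diag)
  then show ?case
    using * Mul.IH by simp
next
  case (Inv r)
  then obtain A1 B1 where *: "nc_eval k Z r = Some A1" "nc_eval l W r = Some B1"
    "mat_inverse A1 = Some A" "mat_inverse B1 = Some B"
    by (auto simp: bind_eq_Some_conv)
  have c: "A1 \<in> carrier_mat k k" "B1 \<in> carrier_mat l l"
    using * Z W nc_eval_carrier by blast+
  then have i: "A \<in> carrier_mat k k" "B \<in> carrier_mat l l" "A1 * A = 1\<^sub>m k" "B1 * B = 1\<^sub>m l"
    using * mat_inverse_eq_Some_iff by blast+
  have "block_diag A1 B1 * block_diag A B = 1\<^sub>m (k + l)"
    unfolding mult_block_diag[OF c(1) i(1) c(2) i(2)] i by (simp add: block_diag_def)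
  then have "mat_inverse (block_diag A1 B1) = Some (block_diag A B)"
    using c i mat_inverse_eq_Some_iff[of "block_diag A1 B1" "k + l"] block_diag_carrier by blast
  then show ?case
    using * Inv.IH by simp
qed auto

text \<open>The count is off by one, so that there is always at least one block: the argument
  \<open>m\<close> gives \<open>Suc m\<close> diagonal copies.\<close>

primrec block_copies :: "nat \<Rightarrow> 'a::zero mat \<Rightarrow> 'a mat" where
  "block_copies 0 A = A"
| "block_copies (Suc m) A = block_diag A (block_copies m A)"

lemma block_copies_carrier:
  "A \<in> carrier_mat k k \<Longrightarrow> block_copies m A \<in> carrier_mat (Suc m * k) (Suc m * k)"
  by (induction m) (auto intro: block_diag_carrier)

lemma mat_tuple_block_copies:
  "mat_tuple k Z \<Longrightarrow> mat_tuple (Suc m * k) (\<lambda>v. block_copies m (Z v))"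
  unfolding mat_tuple_def using block_copies_carrier by blast

lemma nc_eval_block_copies:
  assumes "mat_tuple k Z" "nc_eval k Z r = Some A"
  shows "nc_eval (Suc m * k) (\<lambda>v. block_copies m (Z v)) r = Some (block_copies m A)"
proof (induction m)
  case (Suc m)
  then show ?case
    using nc_eval_block_diag[OF assms(1) mat_tuple_block_copies[OF assms(1), of m] assms(2) Suc]
    by (simp add: algebra_simps)
qed (use assms in simp)

lemma block_copies_inject:
  assumes "block_copies m A = block_copies m B" "A \<in> carrier_mat k k" "B \<in> carrier_mat k k"
  shows "A = B"
proof (cases m)
  case (Suc l)
  then show ?thesis
    using assms block_diag_inject_left[OF _ assms(2,3)] block_copies_carrier by (metis block_copies.simps(2))
qed (use assms in simp)

lemma smult_smult_mat: "a \<cdot>\<^sub>m (b \<cdot>\<^sub>m A) = (a * b :: 'a :: semigroup_mult) \<cdot>\<^sub>m A"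
  by (intro eq_matI) (auto simp: mult.assoc)

section \<open>Rational dependence on a parameter\<close>

abbreviation mat_at :: "complex poly mat \<Rightarrow> complex \<Rightarrow> complex mat" where
  "mat_at M t \<equiv> map_mat (\<lambda>q. poly q t) M"

lemma mat_at_mult:
  assumes "M \<in> carrier_mat k k" "N \<in> carrier_mat k k"
  shows "mat_at (M * N) t = mat_at M t * mat_at N t"
  using assms by (intro eq_matI) (auto simp: scalar_prod_def poly_sum)

lemma det_mat_at: "det (mat_at M t) = poly (det M) t"
  by (rule comm_ring_hom.hom_det) (unfold_locales, auto)

text \<open>Along a polynomial curve a value is a polynomial matrix over one scalar denominator.
  Sums and products multiply denominators; an inverse contributes a determinant by the adjugate
  formula. The denominator is nonzero at \<open>t0\<close>, so only finitely many parameters are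
  lost.\<close>

lemma nc_eval_rational:
  fixes W :: "'v \<Rightarrow> complex poly mat"
  assumes W: "\<And>v. W v \<in> carrier_mat k k"
  shows "nc_eval k (\<lambda>v. mat_at (W v) t0) r = Some A \<Longrightarrow>
    \<exists>p M. M \<in> carrier_mat k k \<and> poly p t0 \<noteq> 0 \<and>
      (\<forall>t. poly p t \<noteq> 0 \<longrightarrow>
         nc_eval k (\<lambda>v. mat_at (W v) t) r = Some (inverse (poly p t) \<cdot>\<^sub>m mat_at M t))"
proof (induction r arbitrary: A)
  case (Var v)
  show ?case
    by (rule exI[of _ 1], rule exI[of _ "W v"]) (use W[of v] in auto)
next
  case One
  show ?case
    by (rule exI[of _ 1], rule exI[of _ "1\<^sub>m k"]) (auto intro!: eq_matI)
next
  case (Scale c r)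
  then obtain A' where "nc_eval k (\<lambda>v. mat_at (W v) t0) r = Some A'"
    by (auto simp: bind_eq_Some_conv)
  from Scale.IH[OF this] obtain p M where pM: "M \<in> carrier_mat k k" "poly p t0 \<noteq> 0"
    "\<And>t. poly p t \<noteq> 0 \<Longrightarrow> nc_eval k (\<lambda>v. mat_at (W v) t) r = Some (inverse (poly p t) \<cdot>\<^sub>m mat_at M t)"
    by blast
  show ?case
    by (rule exI[of _ p], rule exI[of _ "[:c:] \<cdot>\<^sub>m M"]) (use pM in \<open>auto intro!: eq_matI\<close>)
next
  case (Add r s)
  then obtain A1 A2 where "nc_eval k (\<lambda>v. mat_at (W v) t0) r = Some A1"
    "nc_eval k (\<lambda>v. mat_at (W v) t0) s = Some A2"
    by (auto simp: bind_eq_Some_conv)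
  with Add.IH obtain p M q N where pM: "M \<in> carrier_mat k k" "poly p t0 \<noteq> 0"
    "\<And>t. poly p t \<noteq> 0 \<Longrightarrow> nc_eval k (\<lambda>v. mat_at (W v) t) r = Some (inverse (poly p t) \<cdot>\<^sub>m mat_at M t)"
    and qN: "N \<in> carrier_mat k k" "poly q t0 \<noteq> 0"
    "\<And>t. poly q t \<noteq> 0 \<Longrightarrow> nc_eval k (\<lambda>v. mat_at (W v) t) s = Some (inverse (poly q t) \<cdot>\<^sub>m mat_at N t)"
    by metis
  show ?case
    by (rule exI[of _ "p * q"], rule exI[of _ "q \<cdot>\<^sub>m M + p \<cdot>\<^sub>m N"])
      (use pM qN in \<open>auto intro!: eq_matI simp: field_simps\<close>)
next
  case (Mul r s)
  then obtain A1 A2 where "nc_eval k (\<lambda>v. mat_at (W v) t0) r = Some A1"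
    "nc_eval k (\<lambda>v. mat_at (W v) t0) s = Some A2"
    by (auto simp: bind_eq_Some_conv)
  with Mul.IH obtain p M q N where pM: "M \<in> carrier_mat k k" "poly p t0 \<noteq> 0"
    "\<And>t. poly p t \<noteq> 0 \<Longrightarrow> nc_eval k (\<lambda>v. mat_at (W v) t) r = Some (inverse (poly p t) \<cdot>\<^sub>m mat_at M t)"
    and qN: "N \<in> carrier_mat k k" "poly q t0 \<noteq> 0"
    "\<And>t. poly q t \<noteq> 0 \<Longrightarrow> nc_eval k (\<lambda>v. mat_at (W v) t) s = Some (inverse (poly q t) \<cdot>\<^sub>m mat_at N t)"
    by metis
  have "(inverse a \<cdot>\<^sub>m mat_at M t) * (inverse b \<cdot>\<^sub>m mat_at N t) = inverse (a * b) \<cdot>\<^sub>m mat_at (M * N) t"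
    for a b t
    unfolding mat_at_mult[OF pM(1) qN(1)] using pM(1) qN(1)
    by (simp add: mult_smult_assoc_mat[of _ k k _ k] mult_smult_distrib[of _ k k _ k]
        mult.commute smult_smult_mat)
  then show ?case
    by (intro exI[of _ "p * q"] exI[of _ "M * N"]) (use pM qN in auto)
next
  case (Inv r)
  then obtain A1 where A1: "nc_eval k (\<lambda>v. mat_at (W v) t0) r = Some A1" "mat_inverse A1 = Some A"
    by (auto simp: bind_eq_Some_conv)
  with Inv.IH obtain p M where pM: "M \<in> carrier_mat k k" "poly p t0 \<noteq> 0"
    "\<And>t. poly p t \<noteq> 0 \<Longrightarrow> nc_eval k (\<lambda>v. mat_at (W v) t) r = Some (inverse (poly p t) \<cdot>\<^sub>m mat_at M t)"
    by metis
  note adj = adj_mat[OF pM(1)]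
  have Mt: "mat_at M t \<in> carrier_mat k k" for t
    using pM(1) by simp
  have A1_eq: "A1 = inverse (poly p t0) \<cdot>\<^sub>m mat_at M t0"
    using A1 pM by simp
  have "A1 \<in> carrier_mat k k"
    unfolding A1_eq using Mt by simp
  then have "A \<in> carrier_mat k k" "A1 * A = 1\<^sub>m k"
    using A1 mat_inverse_eq_Some_iff by blast+
  then have "det A1 * det A = 1"
    using \<open>A1 \<in> carrier_mat k k\<close> by (metis det_mult det_one)
  then have d0: "poly (det M) t0 \<noteq> 0"
    unfolding A1_eq by (auto simp: det_smult det_mat_at)
  \<comment> \<open>The inverse of \<open>M\<close> over \<open>p\<close> is \<open>p\<close> times
    the adjugate over \<open>det M\<close>. Expanding by \<open>p\<close> keeps \<open>p\<close> in
    the denominator, so that where the latter is nonzero \<open>r\<close> itself is known to be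
    defined.\<close>
  have "mat_inverse (inverse (poly p t) \<cdot>\<^sub>m mat_at M t) =
      Some (inverse (poly (p * det M) t) \<cdot>\<^sub>m mat_at ((p * p) \<cdot>\<^sub>m adj_mat M) t)"
    if "poly (p * det M) t \<noteq> 0" for t
  proof -
    have "mat_at M t * mat_at (adj_mat M) t = poly (det M) t \<cdot>\<^sub>m 1\<^sub>m k"
      unfolding mat_at_mult[OF pM(1) adj(1), symmetric] adj(2) by (auto intro!: eq_matI)
    moreover have "mat_at ((p * p) \<cdot>\<^sub>m adj_mat M) t = poly (p * p) t \<cdot>\<^sub>m mat_at (adj_mat M) t"
      by (auto intro!: eq_matI)
    ultimately show ?thesis
      using that adj(1) pM(1)
      by (subst mat_inverse_eq_Some_iff[of _ k])
        (auto intro!: eq_matI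
          simp: mult_smult_assoc_mat[of _ k k _ k] mult_smult_distrib[of _ k k _ k] field_simps)
  qed
  then show ?case
    by (intro exI[of _ "p * det M"] exI[of _ "(p * p) \<cdot>\<^sub>m adj_mat M"])
      (use pM d0 adj(1) in auto)
qed

section \<open>The equivalence of expressions\<close>

text \<open>An expression that is defined somewhere on a line is defined at all but finitely many
  points of it, so a rational identity that holds wherever a third expression is defined
  extends to the whole line.\<close>

lemma nc_eval_eq_on_line:
  assumes Z: "mat_tuple k Z" and Z': "mat_tuple k Z'"
    and r: "nc_eval k Z r = Some A" and t: "nc_eval k Z t = Some B"
    and s: "nc_eval k Z' s = Some C"
    and eq: "\<And>W A B C. mat_tuple k W \<Longrightarrow> nc_eval k W r = Some A \<Longrightarrow> nc_eval k W t = Some B \<Longrightarrow>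
      nc_eval k W s = Some C \<Longrightarrow> A = B"
  shows "A = B"
proof -
  \<comment> \<open>The line through \<open>Z\<close> at parameter 0 and \<open>Z'\<close> at
    parameter 1, with entries as polynomials in the parameter.\<close>
  define W where "W v = mat k k (\<lambda>ij. [:Z v $$ ij, Z' v $$ ij - Z v $$ ij:])" for v
  have W: "W v \<in> carrier_mat k k" for v
    by (simp add: W_def)
  have dims: "dim_row (Z v) = k" "dim_col (Z v) = k" "dim_row (Z' v) = k" "dim_col (Z' v) = k" for v
    using Z Z' carrier_matD unfolding mat_tuple_def by blast+
  have W0: "(\<lambda>v. mat_at (W v) 0) = Z"
    by (intro ext eq_matI) (auto simp: W_def dims)
  have W1: "(\<lambda>v. mat_at (W v) 1) = Z'"
    by (intro ext eq_matI) (auto simp: W_def dims)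
  have Wt: "mat_tuple k (\<lambda>v. mat_at (W v) t)" for t
    using W by (simp add: mat_tuple_def)
  from nc_eval_rational[of W k 0 r A] W W0 r obtain p M where pM: "M \<in> carrier_mat k k" "poly p 0 \<noteq> 0"
    "\<And>x. poly p x \<noteq> 0 \<Longrightarrow> nc_eval k (\<lambda>v. mat_at (W v) x) r = Some (inverse (poly p x) \<cdot>\<^sub>m mat_at M x)"
    by auto
  from nc_eval_rational[of W k 0 t B] W W0 t obtain q N where qN: "N \<in> carrier_mat k k" "poly q 0 \<noteq> 0"
    "\<And>x. poly q x \<noteq> 0 \<Longrightarrow> nc_eval k (\<lambda>v. mat_at (W v) x) t = Some (inverse (poly q x) \<cdot>\<^sub>m mat_at N x)"
    by auto
  from nc_eval_rational[of W k 1 s C] W W1 s obtain h L where hL: "poly h 1 \<noteq> 0"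
    "\<And>x. poly h x \<noteq> 0 \<Longrightarrow> nc_eval k (\<lambda>v. mat_at (W v) x) s = Some (inverse (poly h x) \<cdot>\<^sub>m mat_at L x)"
    by auto
  have pqh: "p * q * h \<noteq> 0"
    using pM(2) qN(2) hL(1) by auto
  have "q * M $$ (i, j) = p * N $$ (i, j)" if ij: "i < k" "j < k" for i j
  proof -
    \<comment> \<open>Nothing is known at the roots of \<open>p * q * h\<close>; multiplying by this
      polynomial makes the product vanish there too. It then vanishes everywhere, hence is zero, and
      the nonzero factor cancels.\<close>
    have "poly (p * q * h * (q * M $$ (i, j) - p * N $$ (i, j))) x = 0" for x
    proof (cases "poly (p * q * h) x = 0")
      case False
      then have "inverse (poly p x) \<cdot>\<^sub>m mat_at M x = inverse (poly q x) \<cdot>\<^sub>m mat_at N x"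
        using eq[OF Wt pM(3) qN(3) hL(2)] by simp
      then have "(inverse (poly p x) \<cdot>\<^sub>m mat_at M x) $$ (i, j) = (inverse (poly q x) \<cdot>\<^sub>m mat_at N x) $$ (i, j)"
        by simp
      then have "inverse (poly p x) * poly (M $$ (i, j)) x = inverse (poly q x) * poly (N $$ (i, j)) x"
        using ij pM(1) qN(1) by simp
      then show ?thesis
        using False by (simp add: field_simps)
    qed simp
    then have "p * q * h * (q * M $$ (i, j) - p * N $$ (i, j)) = 0"
      using poly_all_0_iff_0 by blast
    then show ?thesis
      using pqh by auto
  qed
  then have "poly q 0 * poly (M $$ (i, j)) 0 = poly p 0 * poly (N $$ (i, j)) 0" if "i < k" "j < k" for i j
    using that by (metis poly_mult)
  moreover have "A = inverse (poly p 0) \<cdot>\<^sub>m mat_at M 0" "B = inverse (poly q 0) \<cdot>\<^sub>m mat_at N 0"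
    using pM(3)[OF pM(2)] qN(3)[OF qN(2)] W0 r t by auto
  ultimately show ?thesis
    using pM(1,2) qN(1,2) by (auto intro!: eq_matI simp: field_simps)
qed

text \<open>The middle expression may be undefined at every point of the given size; passing to
  several diagonal copies reaches a size at which it is defined somewhere.\<close>

lemma nc_equiv_trans:
  assumes "(r, s) \<in> nc_equiv" "(s, t) \<in> nc_equiv"
  shows "(r, t) \<in> nc_equiv"
proof -
  have nd: "nondegenerate r" "nondegenerate s" "nondegenerate t"
    using assms by (auto simp: nc_equiv_def)
  then obtain l V C where V: "l > 0" "mat_tuple l V" "nc_eval l V s = Some C"
    by (auto simp: nondegenerate_def)
  have "A = B" if k: "k > 0" and Z: "mat_tuple k Z" and r: "nc_eval k Z r = Some A"
    and t: "nc_eval k Z t = Some B" for k Z A B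
  proof -
    obtain m n where mn: "k = Suc m" "l = Suc n"
      using k V(1) gr0_implies_Suc by blast
    \<comment> \<open>\<open>l\<close> copies of \<open>Z\<close> and \<open>k\<close> copies of
      \<open>V\<close> have the same size; \<open>n\<close> and \<open>m\<close> are the
      predecessors because \<open>block_copies\<close> counts from one block.\<close>
    have kl: "Suc n * k = Suc m * l"
      unfolding mn by simp
    have "block_copies n A = block_copies n B"
    proof (rule nc_eval_eq_on_line)
      show "mat_tuple (Suc n * k) (\<lambda>v. block_copies n (Z v))"
        using mat_tuple_block_copies[OF Z] .
      show "mat_tuple (Suc n * k) (\<lambda>v. block_copies m (V v))"
        unfolding kl using mat_tuple_block_copies[OF V(2)] .
      show "nc_eval (Suc n * k) (\<lambda>v. block_copies n (Z v)) r = Some (block_copies n A)"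
        using nc_eval_block_copies[OF Z r] .
      show "nc_eval (Suc n * k) (\<lambda>v. block_copies n (Z v)) t = Some (block_copies n B)"
        using nc_eval_block_copies[OF Z t] .
      show "nc_eval (Suc n * k) (\<lambda>v. block_copies m (V v)) s = Some (block_copies m C)"
        unfolding kl using nc_eval_block_copies[OF V(2,3)] .
      have "Suc n * k > 0"
        using k by simp
      then show "A = B" if "mat_tuple (Suc n * k) W" "nc_eval (Suc n * k) W r = Some A"
        "nc_eval (Suc n * k) W t = Some B" "nc_eval (Suc n * k) W s = Some C" for W A B C
        using assms that unfolding nc_equiv_def by blast
    qed
    then show ?thesis
      using block_copies_inject nc_eval_carrier[OF Z r] nc_eval_carrier[OF Z t] by blast
  qed
  then show ?thesis
    using nd by (auto simp: nc_equiv_def)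
qed

lemma nc_equiv_sym: "(r, s) \<in> nc_equiv \<Longrightarrow> (s, r) \<in> nc_equiv"
  unfolding nc_equiv_def by (safe; metis)

lemma nc_equivI:
  assumes "nondegenerate r" "nondegenerate s"
    "\<And>k Z A B. k > 0 \<Longrightarrow> mat_tuple k Z \<Longrightarrow> nc_eval k Z r = Some A \<Longrightarrow> nc_eval k Z s = Some B \<Longrightarrow>
      A = B"
  shows "(r, s) \<in> nc_equiv"
  using assms unfolding nc_equiv_def by blast

lemma nc_equiv_refl: "nondegenerate r \<Longrightarrow> (r, r) \<in> nc_equiv"
  by (auto simp: nc_equiv_def)

lemma nc_equiv_nondegenerate:
  "(r, s) \<in> nc_equiv \<Longrightarrow> nondegenerate r" "(r, s) \<in> nc_equiv \<Longrightarrow> nondegenerate s"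
  by (auto simp: nc_equiv_def)

lemma nc_equiv_eval:
  "(r, s) \<in> nc_equiv \<Longrightarrow> k > 0 \<Longrightarrow> mat_tuple k Z \<Longrightarrow> nc_eval k Z r = Some A \<Longrightarrow>
    nc_eval k Z s = Some B \<Longrightarrow> A = B"
  unfolding nc_equiv_def by blast

section \<open>Operations on rational functions through representatives\<close>

text \<open>For a degenerate \<open>r\<close> this is the empty set, which is why the computation
  rules below assume that the combined expression is nondegenerate.\<close>

definition nc_class :: "'v nc_expr \<Rightarrow> 'v nc_fun" where
  "nc_class r = nc_equiv `` {r}"

lemma nc_class_mem_iff: "s \<in> nc_class r \<longleftrightarrow> (r, s) \<in> nc_equiv"
  by (simp add: nc_class_def)

lemma nc_class_self: "nondegenerate r \<Longrightarrow> r \<in> nc_class r"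
  by (simp add: nc_class_mem_iff nc_equiv_refl)

lemma nc_class_in_functions: "nondegenerate r \<Longrightarrow> nc_class r \<in> nc_functions"
  by (auto simp: nc_functions_def nc_class_def intro: quotientI)

lemma nc_class_eq: "(r, s) \<in> nc_equiv \<Longrightarrow> nc_class r = nc_class s"
  unfolding nc_class_def using nc_equiv_trans nc_equiv_sym by blast

text \<open>The common scheme for well-definedness: \<open>S\<close> collects the results over all
  choices of representatives. Degenerate members of \<open>S\<close> add nothing to the image, so
  only nondegenerate ones have to be compared with \<open>r\<close>.\<close>

lemma Image_nc_equiv_eq_class:
  assumes "r \<in> S" "\<And>s. s \<in> S \<Longrightarrow> nondegenerate s \<Longrightarrow> (r, s) \<in> nc_equiv"
  shows "nc_equiv `` S = nc_class r"
proof
  show "nc_class r \<subseteq> nc_equiv `` S"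
    using assms(1) by (auto simp: nc_class_def)
  show "nc_equiv `` S \<subseteq> nc_class r"
    unfolding nc_class_def using assms(2) nc_equiv_nondegenerate(1) nc_equiv_trans by blast
qed

lemma nondegenerate_subexprs:
  "nondegenerate (Scale c r) \<Longrightarrow> nondegenerate r"
  "nondegenerate (Add r s) \<Longrightarrow> nondegenerate r" "nondegenerate (Add r s) \<Longrightarrow> nondegenerate s"
  "nondegenerate (Mul r s) \<Longrightarrow> nondegenerate r" "nondegenerate (Mul r s) \<Longrightarrow> nondegenerate s"
  "nondegenerate (Inv r) \<Longrightarrow> nondegenerate r"
  unfolding nondegenerate_def by (fastforce simp: bind_eq_Some_conv)+

text \<open>A point at which both combinations are defined also evaluates the representatives inside
  them, and there these agree. The rules for inverses, sums and products follow the same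
  pattern.\<close>

lemma nc_scale_class:
  assumes "nondegenerate (Scale c r)"
  shows "c \<cdot>\<^sub>r nc_class r = nc_class (Scale c r)"
  unfolding nc_scale_def
proof (rule Image_nc_equiv_eq_class)
  show "Scale c r \<in> {Scale c s |s. s \<in> nc_class r}"
    using assms by (auto intro: nc_class_self nondegenerate_subexprs)
next
  fix t assume "t \<in> {Scale c s |s. s \<in> nc_class r}" "nondegenerate t"
  then obtain r' where t: "t = Scale c r'" "(r, r') \<in> nc_equiv"
    by (auto simp: nc_class_mem_iff)
  show "(Scale c r, t) \<in> nc_equiv"
  proof (rule nc_equivI)
    fix k Z A B
    assume k: "k > 0" and Z: "mat_tuple k Z" and "nc_eval k Z (Scale c r) = Some A" "nc_eval k Z t = Some B"
    then obtain A1 B1 where *: "nc_eval k Z r = Some A1" "nc_eval k Z r' = Some B1"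
      "A = c \<cdot>\<^sub>m A1" "B = c \<cdot>\<^sub>m B1"
      by (auto simp: t(1) bind_eq_Some_conv)
    show "A = B"
      using *(3,4) nc_equiv_eval[OF t(2) k Z *(1,2)] by simp
  qed fact+
qed

lemma nc_inv_class:
  assumes "nondegenerate (Inv r)"
  shows "nc_inv (nc_class r) = nc_class (Inv r)"
  unfolding nc_inv_def
proof (rule Image_nc_equiv_eq_class)
  show "Inv r \<in> {Inv s |s. s \<in> nc_class r}"
    using assms by (auto intro: nc_class_self nondegenerate_subexprs)
next
  fix t assume "t \<in> {Inv s |s. s \<in> nc_class r}" "nondegenerate t"
  then obtain r' where t: "t = Inv r'" "(r, r') \<in> nc_equiv"
    by (auto simp: nc_class_mem_iff)
  show "(Inv r, t) \<in> nc_equiv"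
  proof (rule nc_equivI)
    fix k Z A B
    assume k: "k > 0" and Z: "mat_tuple k Z" and "nc_eval k Z (Inv r) = Some A" "nc_eval k Z t = Some B"
    then obtain A1 B1 where *: "nc_eval k Z r = Some A1" "nc_eval k Z r' = Some B1"
      "mat_inverse A1 = Some A" "mat_inverse B1 = Some B"
      by (auto simp: t(1) bind_eq_Some_conv)
    show "A = B"
      using *(3,4) nc_equiv_eval[OF t(2) k Z *(1,2)] by simp
  qed fact+
qed

lemma nc_add_class:
  assumes "nondegenerate (Add r s)"
  shows "nc_class r +\<^sub>r nc_class s = nc_class (Add r s)"
  unfolding nc_add_def
proof (rule Image_nc_equiv_eq_class)
  show "Add r s \<in> {Add r' s' |r' s'. r' \<in> nc_class r \<and> s' \<in> nc_class s}"
    using assms by (auto intro: nc_class_self nondegenerate_subexprs)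
next
  fix t assume "t \<in> {Add r' s' |r' s'. r' \<in> nc_class r \<and> s' \<in> nc_class s}" "nondegenerate t"
  then obtain r' s' where t: "t = Add r' s'" "(r, r') \<in> nc_equiv" "(s, s') \<in> nc_equiv"
    by (auto simp: nc_class_mem_iff)
  show "(Add r s, t) \<in> nc_equiv"
  proof (rule nc_equivI)
    fix k Z A B
    assume k: "k > 0" and Z: "mat_tuple k Z" and "nc_eval k Z (Add r s) = Some A" "nc_eval k Z t = Some B"
    then obtain A1 A2 B1 B2 where *: "nc_eval k Z r = Some A1" "nc_eval k Z s = Some A2"
      "nc_eval k Z r' = Some B1" "nc_eval k Z s' = Some B2" "A = A1 + A2" "B = B1 + B2"
      by (auto simp: t(1) bind_eq_Some_conv)
    show "A = B"
      unfolding *(5,6) nc_equiv_eval[OF t(2) k Z *(1,3)] nc_equiv_eval[OF t(3) k Z *(2,4)] ..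
  qed fact+
qed

lemma nc_mult_class:
  assumes "nondegenerate (Mul r s)"
  shows "nc_class r *\<^sub>r nc_class s = nc_class (Mul r s)"
  unfolding nc_mult_def
proof (rule Image_nc_equiv_eq_class)
  show "Mul r s \<in> {Mul r' s' |r' s'. r' \<in> nc_class r \<and> s' \<in> nc_class s}"
    using assms by (auto intro: nc_class_self nondegenerate_subexprs)
next
  fix t assume "t \<in> {Mul r' s' |r' s'. r' \<in> nc_class r \<and> s' \<in> nc_class s}" "nondegenerate t"
  then obtain r' s' where t: "t = Mul r' s'" "(r, r') \<in> nc_equiv" "(s, s') \<in> nc_equiv"
    by (auto simp: nc_class_mem_iff)
  show "(Mul r s, t) \<in> nc_equiv"
  proof (rule nc_equivI)
    fix k Z A B
    assume k: "k > 0" and Z: "mat_tuple k Z" and "nc_eval k Z (Mul r s) = Some A" "nc_eval k Z t = Some B"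
    then obtain A1 A2 B1 B2 where *: "nc_eval k Z r = Some A1" "nc_eval k Z s = Some A2"
      "nc_eval k Z r' = Some B1" "nc_eval k Z s' = Some B2" "A = A1 * A2" "B = B1 * B2"
      by (auto simp: t(1) bind_eq_Some_conv)
    show "A = B"
      unfolding *(5,6) nc_equiv_eval[OF t(2) k Z *(1,3)] nc_equiv_eval[OF t(3) k Z *(2,4)] ..
  qed fact+
qed

lemma nc_diff_class:
  assumes "nondegenerate (Add r (Scale (-1) s))"
  shows "nc_class r -\<^sub>r nc_class s = nc_class (Add r (Scale (-1) s))"
  unfolding nc_diff_def using assms
  by (simp add: nc_scale_class nc_add_class nondegenerate_subexprs(3))

lemma nc_var_eq_class: "nc_var v = nc_class (Var v)"
  by (simp add: nc_var_def nc_class_def)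

lemma nc_const_eq_class: "nc_const c = nc_class (Scale c One)"
  by (simp add: nc_const_def nc_class_def)

text \<open>Equivalent expressions may involve different variables, so the inner expressions need
  not all be defined at a point where a composition is. The point of evaluation for the outer
  expressions is patched together from whichever of the two inner values exist.\<close>

lemma nc_subst_equiv:
  assumes rs: "(r, s) \<in> nc_equiv" and gh: "\<And>v. (g v, h v) \<in> nc_equiv"
    and nd: "nondegenerate (nc_subst g r)" "nondegenerate (nc_subst h s)"
  shows "(nc_subst g r, nc_subst h s) \<in> nc_equiv"
proof -
  have "A = B" if k: "k > 0" and Z: "mat_tuple k Z" and A: "nc_eval k Z (nc_subst g r) = Some A"
    and B: "nc_eval k Z (nc_subst h s) = Some B" for k Z A B
  proof -
    \<comment> \<open>Preferring \<open>g v\<close> is harmless, since \<open>g v\<close> and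
      \<open>h v\<close> agree where both are defined. The default \<open>0\<^sub>m k k\<close> is
      never met at a variable of \<open>r\<close> or \<open>s\<close>; it keeps \<open>W\<close> a
      tuple of matrices of size \<open>k\<close>.\<close>
    define W where "W v = (case nc_eval k Z (g v) of Some C \<Rightarrow> C
      | None \<Rightarrow> (case nc_eval k Z (h v) of Some C \<Rightarrow> C | None \<Rightarrow> 0\<^sub>m k k))" for v
    have "nc_eval k Z (g v) = Some (W v)" if "v \<in> set_nc_expr r" for v
      using nc_eval_subst_defined[OF A that] by (auto simp: W_def)
    then have "nc_eval k W r = Some A"
      using A nc_eval_subst by metis
    moreover have "nc_eval k Z (h v) = Some (W v)" if "v \<in> set_nc_expr s" for v
    proof -
      obtain C where C: "nc_eval k Z (h v) = Some C"
        using nc_eval_subst_defined[OF B] \<open>v \<in> set_nc_expr s\<close> by blast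
      then show ?thesis
        using nc_equiv_eval[OF gh k Z _ C] by (cases "nc_eval k Z (g v)") (auto simp: W_def)
    qed
    then have "nc_eval k W s = Some B"
      using B nc_eval_subst by metis
    moreover have "mat_tuple k W"
      using nc_eval_carrier[OF Z] by (auto simp: mat_tuple_def W_def split: option.split)
    ultimately show ?thesis
      using nc_equiv_eval[OF rs k] by blast
  qed
  then show ?thesis
    using nd by (auto simp: nc_equiv_def)
qed

lemma nc_compose_class:
  assumes "nondegenerate r" "\<And>v. nondegenerate (g v)" "nondegenerate (nc_subst g r)"
  shows "nc_class r \<circ>\<^sub>r (\<lambda>v. nc_class (g v)) = nc_class (nc_subst g r)"
  unfolding nc_compose_def
proof (rule Image_nc_equiv_eq_class)
  have "r \<in> nc_class r" "\<forall>v. g v \<in> nc_class (g v)"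
    using assms nc_class_self by auto
  then show "nc_subst g r \<in> {nc_subst h s |h s. s \<in> nc_class r \<and> (\<forall>v. h v \<in> nc_class (g v))}"
    by auto
next
  fix t assume "t \<in> {nc_subst h s |h s. s \<in> nc_class r \<and> (\<forall>v. h v \<in> nc_class (g v))}"
    and nd: "nondegenerate t"
  then obtain h s where t: "t = nc_subst h s" "(r, s) \<in> nc_equiv" "\<And>v. (g v, h v) \<in> nc_equiv"
    by (auto simp: nc_class_mem_iff)
  show "(nc_subst g r, t) \<in> nc_equiv"
    using nc_subst_equiv[OF t(2,3) assms(3)] nd t(1) by simp
qed

section \<open>The recursion\<close>

text \<open>The bracketing to the left and the differences written with \<open>Scale (-1)\<close>
  mirror the operations on functions, so the class rules turn these equations into the stated
  recursion.\<close>

fun P_expr Q_expr :: "nat \<Rightarrow> three_vars nc_expr" where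
  "P_expr 0 = Scale 2 One"
| "Q_expr 0 = Scale 0 One"
| "P_expr (Suc n) = Add
    (Mul (Inv (Add (Var Alpha_var)
      (Scale (-1) (Mul (Mul (Var Beta_var) (Inv (Var Gamma_var))) (Var Beta_var))))) (P_expr n))
    (Mul (Inv (Add (Var Beta_var)
      (Scale (-1) (Mul (Mul (Var Gamma_var) (Inv (Var Beta_var))) (Var Alpha_var))))) (Q_expr n))"
| "Q_expr (Suc n) = Add
    (Mul (Mul (Var Beta_var) (Inv (Add (Var Beta_var)
      (Scale (-1) (Mul (Mul (Var Alpha_var) (Inv (Var Beta_var))) (Var Gamma_var)))))) (P_expr n))
    (Mul (Mul (Var Beta_var) (Inv (Add (Var Gamma_var)
      (Scale (-1) (Mul (Mul (Var Beta_var) (Inv (Var Alpha_var))) (Var Beta_var)))))) (Q_expr n))"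

text \<open>The start is \<open>Scale 1 One\<close> because the zeroth power of a function is the
  class of that expression.\<close>

primrec inv_power_expr :: "'v \<Rightarrow> nat \<Rightarrow> 'v nc_expr" where
  "inv_power_expr v 0 = Scale 1 One"
| "inv_power_expr v (Suc n) = Mul (Inv (Var v)) (inv_power_expr v n)"

definition v_expr :: "two_vars nc_expr" where
  "v_expr = Scale (1/2) (Add (Var X_var) (Scale (-1) (Var Y_var)))"

definition u_expr :: "two_vars nc_expr" where
  "u_expr = Scale (1/2) (Add (Var X_var) (Var Y_var))"

definition \<pi>_expr :: "three_vars \<Rightarrow> two_vars nc_expr" where
  "\<pi>_expr = triple3 u_expr (Mul v_expr v_expr) (Mul (Mul v_expr u_expr) v_expr)"

lemma nc_eval_\<pi>_expr:
  assumes "mat_tuple k Z"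
  shows "nc_eval k Z (\<pi>_expr v) = Some (\<pi>_mat (Z X_var) (Z Y_var) v)"
proof -
  have "Z X_var + (-1) \<cdot>\<^sub>m Z Y_var = Z X_var - Z Y_var"
    using assms by (intro eq_matI) (auto simp: mat_tuple_def dest!: carrier_matD)
  then show ?thesis
    by (cases v) (simp_all add: \<pi>_expr_def \<pi>_mat_def u_expr_def v_expr_def u_mat_def v_mat_def Let_def)
qed

section \<open>Nondegeneracy, tested at a point of scalar matrices\<close>

abbreviation scalar1 :: "complex \<Rightarrow> complex mat" where
  "scalar1 c \<equiv> c \<cdot>\<^sub>m 1\<^sub>m 1"

lemma scalar1_arith:
  "scalar1 a + scalar1 b = scalar1 (a + b)" "scalar1 a - scalar1 b = scalar1 (a - b)"
  "scalar1 a * scalar1 b = scalar1 (a * b)" "c \<cdot>\<^sub>m scalar1 a = scalar1 (c * a)"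
  by (auto intro!: eq_matI simp: scalar_prod_def)

lemma mat_inverse_scalar1: "a \<noteq> 0 \<Longrightarrow> mat_inverse (scalar1 a) = Some (scalar1 (inverse a))"
  by (subst mat_inverse_eq_Some_iff[of _ 1]) (auto simp: scalar1_arith intro!: eq_matI)

text \<open>At \<open>x = 3\<close> and \<open>y = 1\<close>, where \<open>\<pi>(x, y) = (2, 1, 2)\<close>, every inverse in the recursion
  exists.\<close>

lemma P_Q_expr_at_point:
  "(\<exists>a. nc_eval 1 (triple3 (scalar1 2) (scalar1 1) (scalar1 2)) (P_expr n) = Some (scalar1 a)) \<and>
   (\<exists>b. nc_eval 1 (triple3 (scalar1 2) (scalar1 1) (scalar1 2)) (Q_expr n) = Some (scalar1 b))"
proof (induction n)
  case (Suc n)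
  then obtain a b where
    "nc_eval 1 (triple3 (scalar1 2) (scalar1 1) (scalar1 2)) (P_expr n) = Some (scalar1 a)"
    "nc_eval 1 (triple3 (scalar1 2) (scalar1 1) (scalar1 2)) (Q_expr n) = Some (scalar1 b)"
    by blast
  \<comment> \<open>Here \<open>v\<close> is 1, and 2/3 and -1/3 are the half sum and half
    difference of the inverses 1/3 and 1.\<close>
  then have
    "nc_eval 1 (triple3 (scalar1 2) (scalar1 1) (scalar1 2)) (P_expr (Suc n)) =
      Some (scalar1 (2 / 3 * a - 1 / 3 * b))"
    "nc_eval 1 (triple3 (scalar1 2) (scalar1 1) (scalar1 2)) (Q_expr (Suc n)) =
      Some (scalar1 (- 1 / 3 * a + 2 / 3 * b))"
    by (simp_all add: scalar1_arith mat_inverse_scalar1 del: One_nat_def)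
  then show ?case
    by blast
qed auto

lemma inv_power_expr_at_point:
  "\<exists>a. nc_eval 1 (pair2 (scalar1 3) (scalar1 1)) (inv_power_expr v n) = Some (scalar1 a)"
proof (induction n)
  case (Suc n)
  then obtain a where
    "nc_eval 1 (pair2 (scalar1 3) (scalar1 1)) (inv_power_expr v n) = Some (scalar1 a)"
    by blast
  moreover have "mat_inverse (scalar1 3) = Some (scalar1 (1 / 3))"
    "mat_inverse (scalar1 1) = Some (scalar1 1)"
    using mat_inverse_scalar1[of 3] mat_inverse_scalar1[of 1] by (simp_all add: field_simps del: One_nat_def)
  ultimately show ?case
    by (cases v) (simp_all add: scalar1_arith del: One_nat_def, blast+)
qed auto

lemma mat_tuple_pair2: "mat_tuple k (pair2 x y) \<longleftrightarrow> x \<in> carrier_mat k k \<and> y \<in> carrier_mat k k"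
  by (metis mat_tuple_def pair2.simps two_vars.exhaust)

lemma mat_tuple_triple3:
  "mat_tuple k (triple3 a b c) \<longleftrightarrow> a \<in> carrier_mat k k \<and> b \<in> carrier_mat k k \<and> c \<in> carrier_mat k k"
  by (metis mat_tuple_def triple3.simps three_vars.exhaust)

lemma \<pi>_mat_point:
  "\<pi>_mat (scalar1 3) (scalar1 1) = triple3 (scalar1 2) (scalar1 1) (scalar1 2)"
  by (simp add: \<pi>_mat_def u_mat_def v_mat_def Let_def scalar1_arith del: One_nat_def)

lemma nondegenerate_P_Q_expr: "nondegenerate (P_expr n)" "nondegenerate (Q_expr n)"
proof -
  have "mat_tuple 1 (triple3 (scalar1 2) (scalar1 1) (scalar1 2))"
    by (simp add: mat_tuple_triple3)
  then show "nondegenerate (P_expr n)" "nondegenerate (Q_expr n)"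
    using P_Q_expr_at_point[of n] zero_less_Suc[of 0, folded One_nat_def] unfolding nondegenerate_def by blast+
qed

lemma nondegenerate_at_point:
  assumes "nc_eval 1 (pair2 (scalar1 3) (scalar1 1)) r = Some A"
  shows "nondegenerate r"
proof -
  have "mat_tuple 1 (pair2 (scalar1 3) (scalar1 1))"
    by (simp add: mat_tuple_pair2)
  then show ?thesis
    using assms zero_less_Suc[of 0, folded One_nat_def] unfolding nondegenerate_def by blast
qed

lemma nondegenerate_\<pi>_expr: "nondegenerate (\<pi>_expr v)"
  by (rule nondegenerate_at_point, rule nc_eval_\<pi>_expr) (simp add: mat_tuple_pair2)

lemma nc_eval_subst_\<pi>_expr:
  assumes "x \<in> carrier_mat k k" "y \<in> carrier_mat k k"
  shows "nc_eval k (pair2 x y) (nc_subst \<pi>_expr r) = nc_eval k (\<pi>_mat x y) r"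
  using nc_eval_\<pi>_expr[of k "pair2 x y"] assms by (intro nc_eval_subst) (simp add: mat_tuple_pair2)

text \<open>A composition of nondegenerate expressions may be defined nowhere, so the point chosen
  for \<open>P_expr\<close> has to lie in the image of \<pi>.\<close>

lemma nondegenerate_subst_P_expr: "nondegenerate (nc_subst \<pi>_expr (P_expr n))"
proof -
  obtain a where "nc_eval 1 (\<pi>_mat (scalar1 3) (scalar1 1)) (P_expr n) = Some (scalar1 a)"
    unfolding \<pi>_mat_point using P_Q_expr_at_point by blast
  then show ?thesis
    by (intro nondegenerate_at_point[of _ "scalar1 a"]) (simp add: nc_eval_subst_\<pi>_expr)
qed

lemma nondegenerate_inv_power_sum:
  "nondegenerate (Add (inv_power_expr X_var n) (inv_power_expr Y_var n))"
proof -
  obtain a b where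
    "nc_eval 1 (pair2 (scalar1 3) (scalar1 1)) (inv_power_expr X_var n) = Some (scalar1 a)"
    "nc_eval 1 (pair2 (scalar1 3) (scalar1 1)) (inv_power_expr Y_var n) = Some (scalar1 b)"
    using inv_power_expr_at_point by blast
  then show ?thesis
    by (intro nondegenerate_at_point[of _ "scalar1 a + scalar1 b"]) (simp del: One_nat_def)
qed

section \<open>Representatives of \<pi> and of the negative power sums\<close>

lemma \<pi>_fun_eq_class: "\<pi>_fun = (\<lambda>v. nc_class (\<pi>_expr v))"
proof
  fix v
  have nd: "nondegenerate (Mul v_expr v_expr)" "nondegenerate (Mul (Mul v_expr u_expr) v_expr)"
    "nondegenerate u_expr"
    using nondegenerate_\<pi>_expr[of Beta_var] nondegenerate_\<pi>_expr[of Gamma_var]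
      nondegenerate_\<pi>_expr[of Alpha_var]
    by (simp_all add: \<pi>_expr_def)
  have u: "u_fun = nc_class u_expr"
    unfolding u_fun_def u_expr_def nc_var_eq_class
    using nd(3) nondegenerate_subexprs(1)[OF nd(3)[unfolded u_expr_def]]
    by (simp add: nc_add_class nc_scale_class u_expr_def)
  have ndv: "nondegenerate v_expr"
    using nd(1) nondegenerate_subexprs by blast
  have v: "v_fun = nc_class v_expr"
    unfolding v_fun_def v_expr_def nc_var_eq_class
    using ndv nondegenerate_subexprs(1)[OF ndv[unfolded v_expr_def]]
    by (simp add: nc_diff_class nc_scale_class v_expr_def)
  show "\<pi>_fun v = nc_class (\<pi>_expr v)"
    using nd nondegenerate_subexprs(4)[OF nd(2)]
    by (cases v) (simp_all add: \<pi>_fun_def \<pi>_expr_def u v nc_mult_class)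
qed

lemma nc_power_inv_class:
  "nc_inv (nc_var (v :: two_vars)) ^\<^sub>r n = nc_class (inv_power_expr v n)"
proof (induction n)
  case (Suc n)
  have "nondegenerate (inv_power_expr v (Suc n))"
    using inv_power_expr_at_point[of v "Suc n"] nondegenerate_at_point by blast
  then show ?case
    using Suc nondegenerate_subexprs(4)[of "Inv (Var v)" "inv_power_expr v n"]
    by (simp add: nc_var_eq_class nc_inv_class nc_mult_class)
qed (simp add: nc_const_eq_class)

lemma p_neg_eq_class: "p_neg n = nc_class (Add (inv_power_expr X_var n) (inv_power_expr Y_var n))"
  unfolding p_neg_def nc_power_inv_class by (rule nc_add_class, rule nondegenerate_inv_power_sum)

section \<open>The identity\<close>

text \<open>Identifies an inverse produced by evaluation once a candidate has been checked on one
  side.\<close>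

lemma mat_inverse_eq:
  fixes M N C :: "'a :: field mat"
  assumes "mat_inverse M = Some N" "M \<in> carrier_mat k k" "C \<in> carrier_mat k k" "M * C = 1\<^sub>m k"
  shows "N = C"
  using assms mat_inverse_eq_Some_iff[of M k C] by simp

text \<open>With \<open>a\<close> and \<open>b\<close> the half sum and half difference of \<open>x\<^sup>-\<^sup>1\<close> and \<open>y\<^sup>-\<^sup>1\<close>, the hypotheses
  \<open>ab\<close> say that the block matrices with rows \<open>(u, v), (v, u)\<close> and \<open>(a, b), (b, a)\<close> are inverse
  to each other.\<close>

lemma block_inverse_entries:
  fixes u v a b :: "complex mat"
  assumes carrier: "u \<in> carrier_mat k k" "v \<in> carrier_mat k k" "a \<in> carrier_mat k k" "b \<in> carrier_mat k k"
    and ab: "u * a + v * b = 1\<^sub>m k" "v * a + u * b = 0\<^sub>m k k"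
    and UV: "Ui \<in> carrier_mat k k" "Vi \<in> carrier_mat k k" "u * Ui = 1\<^sub>m k" "v * Vi = 1\<^sub>m k"
  shows "mat_inverse (v * u * v) = Some Gi \<Longrightarrow> (u + (-1) \<cdot>\<^sub>m (v * v * Gi * (v * v))) * a = 1\<^sub>m k"
    and "mat_inverse (v * v) = Some Bi \<Longrightarrow>
      (v * v + (-1) \<cdot>\<^sub>m (v * u * v * Bi * u)) * (b * Vi) = 1\<^sub>m k"
    and "mat_inverse (v * v) = Some Bi \<Longrightarrow>
      (v * v + (-1) \<cdot>\<^sub>m (u * Bi * (v * u * v))) * (Vi * b) = 1\<^sub>m k"
    and "(v * u * v + (-1) \<cdot>\<^sub>m (v * v * Ui * (v * v))) * (Vi * (a * Vi)) = 1\<^sub>m k"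
proof -
  have mc: "A * B \<in> carrier_mat k k" if "A \<in> carrier_mat k k" "B \<in> carrier_mat k k" for A B :: "complex mat"
    using that by simp
  have assoc: "A * B * C = A * (B * C)"
    if "A \<in> carrier_mat k k" "B \<in> carrier_mat k k" "C \<in> carrier_mat k k" for A B C :: "complex mat"
    using that by simp
  note c = UV(2,1) and uUi = UV(3) and vVi = UV(4)
  have Viv: "Vi * v = 1\<^sub>m k"
    using mat_mult_left_right_inverse[OF carrier(2) c(1) vVi] .
  have Uiu: "Ui * u = 1\<^sub>m k"
    using mat_mult_left_right_inverse[OF carrier(1) c(2) uUi] .
  have cancel: "v * (Vi * z) = z" "Vi * (v * z) = z" "u * (Ui * z) = z" "Ui * (u * z) = z"
    if "z \<in> carrier_mat k k" for z
    using that vVi Viv uUi Uiu carrier c by (simp_all flip: assoc)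
  note simps = assoc mc cancel carrier c
  have Bi_eq: "Bi = Vi * Vi" if "mat_inverse (v * v) = Some Bi"
    by (rule mat_inverse_eq[OF that, of k]) (simp_all add: simps vVi)
  have Gi_eq: "Gi = Vi * (Ui * Vi)" if "mat_inverse (v * u * v) = Some Gi"
    by (rule mat_inverse_eq[OF that, of k]) (simp_all add: simps vVi)
  have va: "v * a = (-1) \<cdot>\<^sub>m (u * b)"
  proof (rule eq_matI)
    fix i j assume "i < dim_row ((-1) \<cdot>\<^sub>m (u * b))" "j < dim_col ((-1) \<cdot>\<^sub>m (u * b))"
    then have ij: "i < k" "j < k"
      using carrier by auto
    have "(v * a + u * b) $$ (i, j) = 0"
      unfolding ab using ij by simp
    then show "(v * a) $$ (i, j) = ((-1) \<cdot>\<^sub>m (u * b)) $$ (i, j)"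
      using ij carrier by (simp add: add_eq_0_iff2)
  qed (use carrier in auto)
  \<comment> \<open>The same relation solved the other way. As rewrite rules the two directions
    would loop together, so each of the four computations uses only one.\<close>
  have ub: "u * b = (-1) \<cdot>\<^sub>m (v * a)"
    unfolding va smult_smult_mat by (intro eq_matI) auto
  have sm: "s \<cdot>\<^sub>m A * B = s \<cdot>\<^sub>m (A * B)" "A * (s \<cdot>\<^sub>m B) = s \<cdot>\<^sub>m (A * B)"
    if "A \<in> carrier_mat k k" "B \<in> carrier_mat k k" for A B :: "complex mat" and s
    using mult_smult_assoc_mat[OF that] mult_smult_distrib[OF that] by auto
  have ring: "(A + B) * C = A * C + B * C" "C * (A + B) = C * A + C * B"
    if "A \<in> carrier_mat k k" "B \<in> carrier_mat k k" "C \<in> carrier_mat k k" for A B C :: "complex mat"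
    using add_mult_distrib_mat[OF that] mult_add_distrib_mat[OF that(3,1,2)] by auto
  have sc: "s \<cdot>\<^sub>m A \<in> carrier_mat k k" if "A \<in> carrier_mat k k" for A :: "complex mat" and s
    using that by simp
  have one: "(1::complex) \<cdot>\<^sub>m A = A" for A
    by (intro eq_matI) auto
  have vaz: "v * (a * z) = (-1) \<cdot>\<^sub>m (u * (b * z))" "u * (b * z) = (-1) \<cdot>\<^sub>m (v * (a * z))"
    if "z \<in> carrier_mat k k" for z
    using arg_cong[OF va, of "\<lambda>m. m * z"] arg_cong[OF ub, of "\<lambda>m. m * z"] that carrier
    by (simp_all add: assoc mc sm)
  have abz: "u * (a * z) + v * (b * z) = z" if "z \<in> carrier_mat k k" for z
    using arg_cong[OF ab(1), of "\<lambda>m. m * z"] that carrier by (simp add: assoc mc ring)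
  \<comment> \<open>The relation \<open>u * a + v * b = 1\<^sub>m k\<close> conjugated by
    \<open>v\<close>, in which the second and fourth computations end.\<close>
  have abvz: "v * (v * (b * Vi)) + v * (u * (a * Vi)) = 1\<^sub>m k"
  proof -
    have "v * (v * (b * Vi)) + v * (u * (a * Vi)) = v * (u * (a * Vi) + v * (b * Vi))"
      using carrier c by (simp add: ring mc comm_add_mat[of _ k k])
    then show ?thesis
      using abz[OF c(1)] vVi by simp
  qed
  have sums: "v * b + u * a = 1\<^sub>m k" "v * (u * (a * Vi)) + v * (v * (b * Vi)) = 1\<^sub>m k"
    using ab(1) abvz carrier c by (simp_all add: comm_add_mat[of _ k k] mc)
  \<comment> \<open>In each case cancellation leaves one factor \<open>v * a\<close> or
    \<open>u * b\<close>, up to a right factor \<open>Vi\<close>. Exchanging it for minus the other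
    turns the difference into \<open>u * a + v * b\<close> or its conjugate by
    \<open>v\<close>.\<close>
  show "(u + (-1) \<cdot>\<^sub>m (v * v * Gi * (v * v))) * a = 1\<^sub>m k" if "mat_inverse (v * u * v) = Some Gi"
    by (simp add: Gi_eq[OF that] simps sm ring sc va smult_smult_mat one ab(1)[unfolded va])
  show "(v * v + (-1) \<cdot>\<^sub>m (v * u * v * Bi * u)) * (b * Vi) = 1\<^sub>m k" if "mat_inverse (v * v) = Some Bi"
    by (simp add: Bi_eq[OF that] simps sm ring sc vaz(2) smult_smult_mat one abvz)
  show "(v * v + (-1) \<cdot>\<^sub>m (u * Bi * (v * u * v))) * (Vi * b) = 1\<^sub>m k" if "mat_inverse (v * v) = Some Bi"
    by (simp add: Bi_eq[OF that] simps sm ring sc ub smult_smult_mat one sums)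
  show "(v * u * v + (-1) \<cdot>\<^sub>m (v * v * Ui * (v * v))) * (Vi * (a * Vi)) = 1\<^sub>m k"
    by (simp add: simps sm ring sc vaz(1) smult_smult_mat one sums)
qed

text \<open>The induction is joint because each recursion uses both predecessors. In the step,
  invertibility of \<open>u\<close> and \<open>v\<close> is extracted from definedness: the
  evaluation has inverted \<open>v * v\<close>, together with \<open>v * u * v\<close> for
  \<open>P_expr\<close> and \<open>u\<close> for \<open>Q_expr\<close>.\<close>

lemma nc_eval_P_Q_expr:
  fixes x y X Y :: "complex mat"
  assumes carrier: "x \<in> carrier_mat k k" "y \<in> carrier_mat k k" "X \<in> carrier_mat k k" "Y \<in> carrier_mat k k"
    and inv: "x * X = 1\<^sub>m k" "y * Y = 1\<^sub>m k"
  shows "(nc_eval k (\<pi>_mat x y) (P_expr n) = Some A \<longrightarrow>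
      A = ((*) X ^^ n) (1\<^sub>m k) + ((*) Y ^^ n) (1\<^sub>m k)) \<and>
    (nc_eval k (\<pi>_mat x y) (Q_expr n) = Some B \<longrightarrow>
      B = v_mat x y * (((*) X ^^ n) (1\<^sub>m k) - ((*) Y ^^ n) (1\<^sub>m k)))"
proof (induction n arbitrary: A B)
  case 0
  have v: "v_mat x y \<in> carrier_mat k k"
    using carrier by (auto simp: v_mat_def intro!: smult_carrier_mat minus_carrier_mat)
  have "1\<^sub>m k - 1\<^sub>m k = (0\<^sub>m k k :: complex mat)"
    by (intro eq_matI) auto
  then have "v_mat x y * (1\<^sub>m k - 1\<^sub>m k) = 0\<^sub>m k k"
    by (simp only: right_mult_zero_mat[OF v])
  moreover have "(2::complex) \<cdot>\<^sub>m 1\<^sub>m k = 1\<^sub>m k + 1\<^sub>m k" "(0::complex) \<cdot>\<^sub>m 1\<^sub>m k = 0\<^sub>m k k"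
    by (auto intro!: eq_matI)
  ultimately show ?case
    by auto
next
  case (Suc n)
  define u v where "u = u_mat x y" and "v = v_mat x y"
  define a b where "a = (1/2) \<cdot>\<^sub>m (X + Y)" and "b = (1/2) \<cdot>\<^sub>m (X - Y)"
  have c: "u \<in> carrier_mat k k" "v \<in> carrier_mat k k" "a \<in> carrier_mat k k" "b \<in> carrier_mat k k"
    using carrier by (auto simp: u_def v_def u_mat_def v_mat_def a_def b_def
        intro!: smult_carrier_mat minus_carrier_mat)
  define Xn Yn where "Xn = ((*) X ^^ n) (1\<^sub>m k)" and "Yn = ((*) Y ^^ n) (1\<^sub>m k)"
  have cn: "Xn \<in> carrier_mat k k" "Yn \<in> carrier_mat k k"
    unfolding Xn_def Yn_def using carrier by (induction n) auto
  have mc: "M * N \<in> carrier_mat k k" if "M \<in> carrier_mat k k" "N \<in> carrier_mat k k" for M N :: "complex mat"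
    using that by simp
  have assoc: "L * M * N = L * (M * N)"
    if "L \<in> carrier_mat k k" "M \<in> carrier_mat k k" "N \<in> carrier_mat k k" for L M N :: "complex mat"
    using that by simp
  have sm: "s \<cdot>\<^sub>m M * N = s \<cdot>\<^sub>m (M * N)" "M * (s \<cdot>\<^sub>m N) = s \<cdot>\<^sub>m (M * N)"
    if "M \<in> carrier_mat k k" "N \<in> carrier_mat k k" for M N :: "complex mat" and s
    using mult_smult_assoc_mat[OF that] mult_smult_distrib[OF that] by auto
  have ring: "(L + M) * N = L * N + M * N" "N * (L + M) = N * L + N * M"
    "(L - M) * N = L * N - M * N" "N * (L - M) = N * L - N * M"
    if "L \<in> carrier_mat k k" "M \<in> carrier_mat k k" "N \<in> carrier_mat k k" for L M N :: "complex mat"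
    using add_mult_distrib_mat[OF that] mult_add_distrib_mat[OF that(3,1,2)]
      minus_mult_distrib_mat[OF that] mult_minus_distrib_mat[OF that(3,1,2)] by auto
  have closed: "s \<cdot>\<^sub>m M \<in> carrier_mat k k" "M + N \<in> carrier_mat k k" "M - N \<in> carrier_mat k k"
    if "M \<in> carrier_mat k k" "N \<in> carrier_mat k k" for M N :: "complex mat" and s
    using that by auto
  have quarter: "(1/2) \<cdot>\<^sub>m L * ((1/2) \<cdot>\<^sub>m M) + (1/2) \<cdot>\<^sub>m L' * ((1/2) \<cdot>\<^sub>m M') = (1/4) \<cdot>\<^sub>m (L * M + L' * M')"
    if "L \<in> carrier_mat k k" "M \<in> carrier_mat k k" "L' \<in> carrier_mat k k" "M' \<in> carrier_mat k k"
    for L M L' M' :: "complex mat"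
    using that mc by (intro eq_matI) (auto simp: sm field_simps)
  \<comment> \<open>With \<open>L\<close> the identity, \<open>M = y * X\<close> and
    \<open>M' = x * Y\<close>, the brackets expand four times \<open>u * a + v * b\<close> and four
    times \<open>v * a + u * b\<close>; the mixed products cancel.\<close>
  have quarters: "(1/4) \<cdot>\<^sub>m ((L + M + (M' + L)) + (L - M - (M' - L))) = L"
    "(1/4) \<cdot>\<^sub>m ((L - M + (M' - L)) + (L + M - (M' + L))) = 0\<^sub>m k k"
    if "L \<in> carrier_mat k k" "M \<in> carrier_mat k k" "M' \<in> carrier_mat k k" for L M M' :: "complex mat"
    using that by (auto intro!: eq_matI)
  have ab: "u * a + v * b = 1\<^sub>m k" "v * a + u * b = 0\<^sub>m k k"
    unfolding u_def v_def u_mat_def v_mat_def a_def b_def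
    using carrier inv quarters[of "1\<^sub>m k" "y * X" "x * Y"]
    by (simp_all add: quarter closed mc ring)
  have halves: "a * (Xn + Yn) + b * (Xn - Yn) = X * Xn + Y * Yn"
    "b * (Xn + Yn) + a * (Xn - Yn) = X * Xn - Y * Yn"
  proof -
    have "(1/2) \<cdot>\<^sub>m (P + R) + (1/2) \<cdot>\<^sub>m (S + T) + ((1/2) \<cdot>\<^sub>m (P - R) - (1/2) \<cdot>\<^sub>m (S - T)) = P + T"
      "(1/2) \<cdot>\<^sub>m (P - R) + (1/2) \<cdot>\<^sub>m (S - T) + ((1/2) \<cdot>\<^sub>m (P + R) - (1/2) \<cdot>\<^sub>m (S + T)) = P - T"
      if "P \<in> carrier_mat k k" "R \<in> carrier_mat k k" "S \<in> carrier_mat k k" "T \<in> carrier_mat k k"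
      for P R S T :: "complex mat"
      using that by (auto intro!: eq_matI simp: field_simps)
    from this[of "X * Xn" "Y * Xn" "X * Yn" "Y * Yn"]
    show "a * (Xn + Yn) + b * (Xn - Yn) = X * Xn + Y * Yn"
      "b * (Xn + Yn) + a * (Xn - Yn) = X * Xn - Y * Yn"
      unfolding a_def b_def using carrier cn by (simp_all add: sm ring closed mc)
  qed
  have point: "\<pi>_mat x y = triple3 u (v * v) (v * u * v)"
    by (simp add: \<pi>_mat_def u_def v_def Let_def)
  note cl = c mc closed
  have Pn: "Pn = Xn + Yn" if "nc_eval k (\<pi>_mat x y) (P_expr n) = Some Pn" for Pn
    using Suc.IH that by (simp add: Xn_def Yn_def)
  have Qn: "Qn = v * (Xn - Yn)" if "nc_eval k (\<pi>_mat x y) (Q_expr n) = Some Qn" for Qn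
    using Suc.IH that by (simp add: Xn_def Yn_def v_def)
  \<comment> \<open>Inverting the square already inverts \<open>v\<close>, with inverse
    \<open>v * Bi\<close>.\<close>
  have v_inverse: "v * (v * Bi) = 1\<^sub>m k" "v * Bi * v = 1\<^sub>m k" "Bi \<in> carrier_mat k k"
    if "mat_inverse (v * v) = Some Bi" for Bi
  proof -
    have Bi: "Bi \<in> carrier_mat k k" "v * v * Bi = 1\<^sub>m k"
      using that mat_inverse_eq_Some_iff[of "v * v" k] c by auto
    then show v: "v * (v * Bi) = 1\<^sub>m k" "Bi \<in> carrier_mat k k"
      using c by auto
    show "v * Bi * v = 1\<^sub>m k"
      by (rule mat_mult_left_right_inverse[OF _ _ v(1)]) (use c Bi in auto)
  qed
  have cancel: "v * (Vi * z) = z" "Vi * (v * z) = z"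
    if "v * Vi = 1\<^sub>m k" "Vi * v = 1\<^sub>m k" "Vi \<in> carrier_mat k k" "z \<in> carrier_mat k k" for Vi z
    using that c by (simp_all flip: assoc)
  have "A = X * Xn + Y * Yn" if A: "nc_eval k (\<pi>_mat x y) (P_expr (Suc n)) = Some A"
  proof -
    from A obtain Pn' Qn' Gi Bi D E where
      PQ: "nc_eval k (\<pi>_mat x y) (P_expr n) = Some Pn'" "nc_eval k (\<pi>_mat x y) (Q_expr n) = Some Qn'" and
      Gi: "mat_inverse (v * u * v) = Some Gi" and Bi: "mat_inverse (v * v) = Some Bi" and
      D: "mat_inverse (u + (-1) \<cdot>\<^sub>m (v * v * Gi * (v * v))) = Some D" and
      E: "mat_inverse (v * v + (-1) \<cdot>\<^sub>m (v * u * v * Bi * u)) = Some E" and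
      A_eq: "A = D * Pn' + E * Qn'"
      unfolding point by (auto simp: bind_eq_Some_conv)
    define Vi where "Vi = v * Bi"
    have V: "Vi \<in> carrier_mat k k" "v * Vi = 1\<^sub>m k" "Vi * v = 1\<^sub>m k"
      using v_inverse[OF Bi] c by (auto simp: Vi_def)
    have G: "Gi \<in> carrier_mat k k" "v * u * v * Gi = 1\<^sub>m k"
      using Gi mat_inverse_eq_Some_iff[of "v * u * v" k] cl by auto
    \<comment> \<open>The recursion for \<open>P_expr\<close> inverts \<gamma> rather than \<alpha>,
      so an inverse of \<open>u\<close> is recovered from that of \<open>v * u * v\<close>:
      cancelling the outer factors shows it to be \<open>v * Gi * v\<close>.\<close>
    have "Vi = Vi * (v * u * v * Gi)"
      using V(1) by (simp add: G(2))
    also have "\<dots> = u * (v * Gi)"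
      using V c G(1) by (simp add: cancel[OF V(2,3,1)] assoc mc)
    finally have U: "u * (v * (Gi * v)) = 1\<^sub>m k" "v * (Gi * v) \<in> carrier_mat k k"
      using V(3) c G(1) by (auto simp: assoc mc)
    note entries = block_inverse_entries[OF c ab U(2) V(1) U(1) V(2)]
    have D_eq: "D = a"
      by (rule mat_inverse_eq[OF D _ _ entries(1)[OF Gi]]) (simp_all add: cl G(1))
    have E_eq: "E = b * Vi"
      by (rule mat_inverse_eq[OF E _ _ entries(2)[OF Bi]]) (simp_all add: cl V(1) v_inverse(3)[OF Bi])
    show ?thesis
      unfolding A_eq D_eq E_eq Pn[OF PQ(1)] Qn[OF PQ(2)]
      using halves(1) by (simp add: assoc cancel[OF V(2,3,1)] cl cn V(1))
  qed
  moreover have "B = v * (X * Xn - Y * Yn)" if B: "nc_eval k (\<pi>_mat x y) (Q_expr (Suc n)) = Some B"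
  proof -
    from B obtain Pn' Qn' Ai Bi F H where
      PQ: "nc_eval k (\<pi>_mat x y) (P_expr n) = Some Pn'" "nc_eval k (\<pi>_mat x y) (Q_expr n) = Some Qn'" and
      Ai: "mat_inverse u = Some Ai" and Bi: "mat_inverse (v * v) = Some Bi" and
      F: "mat_inverse (v * v + (-1) \<cdot>\<^sub>m (u * Bi * (v * u * v))) = Some F" and
      H: "mat_inverse (v * u * v + (-1) \<cdot>\<^sub>m (v * v * Ai * (v * v))) = Some H" and
      B_eq: "B = v * v * F * Pn' + v * v * H * Qn'"
      unfolding point by (auto simp: bind_eq_Some_conv)
    define Vi where "Vi = v * Bi"
    have V: "Vi \<in> carrier_mat k k" "v * Vi = 1\<^sub>m k" "Vi * v = 1\<^sub>m k"
      using v_inverse[OF Bi] c by (auto simp: Vi_def)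
    have U: "Ai \<in> carrier_mat k k" "u * Ai = 1\<^sub>m k"
      using Ai mat_inverse_eq_Some_iff c by blast+
    note entries = block_inverse_entries[OF c ab U(1) V(1) U(2) V(2)]
    have F_eq: "F = Vi * b"
      by (rule mat_inverse_eq[OF F _ _ entries(3)[OF Bi]]) (simp_all add: cl V(1) v_inverse(3)[OF Bi])
    have H_eq: "H = Vi * (a * Vi)"
      by (rule mat_inverse_eq[OF H _ _ entries(4)]) (simp_all add: cl V(1) U(1))
    have "B = v * (b * (Xn + Yn)) + v * (a * (Xn - Yn))"
      unfolding B_eq F_eq H_eq Pn[OF PQ(1)] Qn[OF PQ(2)]
      by (simp add: assoc cancel[OF V(2,3,1)] cl cn V(1))
    then show ?thesis
      unfolding halves(2)[symmetric] by (simp add: ring(2) cl cn)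
  qed
  ultimately show ?case
    by (simp add: Xn_def Yn_def v_def)
qed

lemma nc_eval_inv_power_expr:
  assumes "mat_inverse (Z v) = Some V"
  shows "nc_eval k Z (inv_power_expr v n) = Some (((*) V ^^ n) (1\<^sub>m k))"
proof (induction n)
  case 0
  have "(1::complex) \<cdot>\<^sub>m 1\<^sub>m k = 1\<^sub>m k"
    by (intro eq_matI) auto
  then show ?case
    by simp
qed (use assms in simp)

lemma p_neg_equiv:
  "(Add (inv_power_expr X_var n) (inv_power_expr Y_var n), nc_subst \<pi>_expr (P_expr n)) \<in> nc_equiv"
proof (rule nc_equivI)
  fix k :: nat and Z :: "two_vars \<Rightarrow> complex mat" and A B
  assume Z: "mat_tuple k Z"
    and A: "nc_eval k Z (Add (inv_power_expr X_var n) (inv_power_expr Y_var n)) = Some A"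
    and B: "nc_eval k Z (nc_subst \<pi>_expr (P_expr n)) = Some B"
  define x y where "x = Z X_var" and "y = Z Y_var"
  have xy: "x \<in> carrier_mat k k" "y \<in> carrier_mat k k"
    using Z by (auto simp: x_def y_def mat_tuple_def)
  have B': "nc_eval k (\<pi>_mat x y) (P_expr n) = Some B"
    using B nc_eval_subst[of "P_expr n" k Z \<pi>_expr "\<pi>_mat x y"] nc_eval_\<pi>_expr[OF Z]
    by (simp add: x_def y_def)
  show "A = B"
  \<comment> \<open>For \<open>n = 0\<close> both sides are the constant 2 and \<open>x\<close>,
    \<open>y\<close> may be singular. For positive \<open>n\<close> definedness of the power sum
    supplies both inverses.\<close>
  proof (cases n)
    case 0
    then show ?thesis
      using A B by (auto intro!: eq_matI)
  next
    case (Suc m)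
    obtain X Y where XY: "mat_inverse x = Some X" "mat_inverse y = Some Y"
      using A Suc by (auto simp: bind_eq_Some_conv x_def y_def)
    then have inv: "X \<in> carrier_mat k k" "Y \<in> carrier_mat k k" "x * X = 1\<^sub>m k" "y * Y = 1\<^sub>m k"
      using mat_inverse_eq_Some_iff xy by blast+
    show ?thesis
      using A nc_eval_P_Q_expr[OF xy inv, of n B] B' XY
      by (simp add: nc_eval_inv_power_expr x_def y_def)
  qed
qed (rule nondegenerate_inv_power_sum nondegenerate_subst_P_expr)+

theorem theorem11p18:
  defines "\<alpha> \<equiv> nc_var Alpha_var"
    and "\<beta> \<equiv> nc_var Beta_var"
    and "\<gamma> \<equiv> nc_var Gamma_var"
  shows "\<exists>P Q :: nat \<Rightarrow> three_vars nc_fun.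
    P 0 = nc_const 2 \<and> Q 0 = nc_const 0 \<and>
    (\<forall>n. P (Suc n) = nc_inv (\<alpha> -\<^sub>r \<beta> *\<^sub>r nc_inv \<gamma> *\<^sub>r \<beta>) *\<^sub>r P n
                      +\<^sub>r nc_inv (\<beta> -\<^sub>r \<gamma> *\<^sub>r nc_inv \<beta> *\<^sub>r \<alpha>) *\<^sub>r Q n) \<and>
    (\<forall>n. Q (Suc n) = \<beta> *\<^sub>r nc_inv (\<beta> -\<^sub>r \<alpha> *\<^sub>r nc_inv \<beta> *\<^sub>r \<gamma>) *\<^sub>r P n
                      +\<^sub>r \<beta> *\<^sub>r nc_inv (\<gamma> -\<^sub>r \<beta> *\<^sub>r nc_inv \<alpha> *\<^sub>r \<beta>) *\<^sub>r Q n) \<and>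
    (\<forall>n. P n \<in> nc_functions \<and> Q n \<in> nc_functions \<and>
      p_neg n \<in> nc_functions \<and> p_neg n = P n \<circ>\<^sub>r \<pi>_fun \<and>
      (\<forall>k>0. \<forall>x \<in> carrier_mat k k. \<forall>y \<in> carrier_mat k k. \<forall>A B.
        nc_value k (p_neg n) (pair2 x y) A \<longrightarrow> nc_value k (P n) (\<pi>_mat x y) B \<longrightarrow> A = B))"
proof -
  define P Q where "P = (\<lambda>n. nc_class (P_expr n))" and "Q = (\<lambda>n. nc_class (Q_expr n))"
  have P_Suc: "P (Suc n) = nc_inv (\<alpha> -\<^sub>r \<beta> *\<^sub>r nc_inv \<gamma> *\<^sub>r \<beta>) *\<^sub>r P n
      +\<^sub>r nc_inv (\<beta> -\<^sub>r \<gamma> *\<^sub>r nc_inv \<beta> *\<^sub>r \<alpha>) *\<^sub>r Q n" for n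
  proof -
    \<comment> \<open>Nondegeneracy of the whole expression passes to all parts; the facts below
      descend one layer at a time so that every class rule finds its hypothesis.\<close>
    note nd = nondegenerate_P_Q_expr(1)[of "Suc n", unfolded P_expr.simps]
    note sub = nondegenerate_subexprs(2,3)[OF nd] nd
    note inv = sub(1,2)[THEN nondegenerate_subexprs(4)]
    note diff = inv[THEN nondegenerate_subexprs(6)]
    note prod = diff[THEN nondegenerate_subexprs(3), THEN nondegenerate_subexprs(1)]
    note left = prod[THEN nondegenerate_subexprs(4)]
    note inner = left[THEN nondegenerate_subexprs(5)]
    show ?thesis
      unfolding P_def Q_def \<alpha>_def \<beta>_def \<gamma>_def nc_var_eq_class
      by (simp add: nc_inv_class nc_add_class nc_mult_class nc_diff_class sub inv diff prod left inner)
  qed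
  have Q_Suc: "Q (Suc n) = \<beta> *\<^sub>r nc_inv (\<beta> -\<^sub>r \<alpha> *\<^sub>r nc_inv \<beta> *\<^sub>r \<gamma>) *\<^sub>r P n
      +\<^sub>r \<beta> *\<^sub>r nc_inv (\<gamma> -\<^sub>r \<beta> *\<^sub>r nc_inv \<alpha> *\<^sub>r \<beta>) *\<^sub>r Q n" for n
  proof -
    note nd = nondegenerate_P_Q_expr(2)[of "Suc n", unfolded Q_expr.simps]
    note sub = nondegenerate_subexprs(2,3)[OF nd] nd
    note fac = sub(1,2)[THEN nondegenerate_subexprs(4)]
    note inv = fac[THEN nondegenerate_subexprs(5)]
    note diff = inv[THEN nondegenerate_subexprs(6)]
    note prod = diff[THEN nondegenerate_subexprs(3), THEN nondegenerate_subexprs(1)]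
    note left = prod[THEN nondegenerate_subexprs(4)]
    note inner = left[THEN nondegenerate_subexprs(5)]
    show ?thesis
      unfolding P_def Q_def \<alpha>_def \<beta>_def \<gamma>_def nc_var_eq_class
      by (simp add: nc_inv_class nc_add_class nc_mult_class nc_diff_class sub fac inv diff prod left inner)
  qed
  have comp: "p_neg n = P n \<circ>\<^sub>r \<pi>_fun" and comp': "P n \<circ>\<^sub>r \<pi>_fun = nc_class (nc_subst \<pi>_expr (P_expr n))" for n
    unfolding P_def \<pi>_fun_eq_class p_neg_eq_class nc_class_eq[OF p_neg_equiv]
      nc_compose_class[OF nondegenerate_P_Q_expr(1) nondegenerate_\<pi>_expr nondegenerate_subst_P_expr]
    by (rule refl)+
  \<comment> \<open>The representatives \<open>r\<close> and \<open>s\<close> are arbitrary, and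
    \<open>P_expr n\<close> may be undefined at this point. Substituting \<open>\<pi>_expr\<close>
    into \<open>s\<close> gives an expression equivalent to \<open>r\<close>, and both are defined
    at \<open>pair2 x y\<close>.\<close>
  have eval_eq: "A = B" if k: "k > 0" and x: "x \<in> carrier_mat k k" and y: "y \<in> carrier_mat k k"
    and A: "nc_value k (p_neg n) (pair2 x y) A" and B: "nc_value k (P n) (\<pi>_mat x y) B" for n k x y A B
  proof -
    have Z: "mat_tuple k (pair2 x y)"
      using x y by (simp add: mat_tuple_pair2)
    obtain r where r: "r \<in> p_neg n" "nc_eval k (pair2 x y) r = Some A"
      using A by (auto simp: nc_value_def)
    obtain s where s: "s \<in> P n" "nc_eval k (\<pi>_mat x y) s = Some B"
      using B by (auto simp: nc_value_def)
    have s_eval: "nc_eval k (pair2 x y) (nc_subst \<pi>_expr s) = Some B"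
      using s(2) nc_eval_subst_\<pi>_expr[OF x y] by simp
    then have nd: "nondegenerate (nc_subst \<pi>_expr s)"
      using k Z unfolding nondegenerate_def by blast
    have "(nc_subst \<pi>_expr (P_expr n), r) \<in> nc_equiv"
      using r(1) unfolding comp comp' nc_class_mem_iff .
    moreover have "(nc_subst \<pi>_expr (P_expr n), nc_subst \<pi>_expr s) \<in> nc_equiv"
      using nc_subst_equiv[OF _ nc_equiv_refl[OF nondegenerate_\<pi>_expr] nondegenerate_subst_P_expr nd] s(1)
      unfolding P_def nc_class_mem_iff .
    ultimately have "(r, nc_subst \<pi>_expr s) \<in> nc_equiv"
      using nc_equiv_sym nc_equiv_trans by blast
    then show ?thesis
      using nc_equiv_eval k Z r(2) s_eval by blast
  qed
  have fns: "P n \<in> nc_functions" "Q n \<in> nc_functions" "p_neg n \<in> nc_functions" for n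
    unfolding P_def Q_def p_neg_eq_class
    by (intro nc_class_in_functions nondegenerate_P_Q_expr nondegenerate_inv_power_sum)+
  have zero: "P 0 = nc_const 2" "Q 0 = nc_const 0"
    by (simp_all add: P_def Q_def nc_const_eq_class)
  show ?thesis
    by (rule exI[of _ P], rule exI[of _ Q]) (use zero P_Suc Q_Suc fns comp eval_eq in blast)
qed

end
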